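(* If $\mathcal{G}^*$ is obtained by solving the amortized training problem $$\mathcal{G}^*=\arg\min_{\mathcal{G}}\mathcal{R}(\mathcal{G})=\arg\min_{\mathcal{G}}\ \mathbb{E}_{B\sim\mu}\,\mathbb{E}_{\mathbf{x}_0\sim\rho}\; J_B\big(\mathbf{x}(t),\mathcal{G}(B,\mathbf{x}_0)\big)\quad\text{s.t.}\quad \dot{\mathbf{x}}(t)=\mathbf{f}\big(t,\mathbf{x}(t),\mathcal{G}(B,\mathbf{x}_0)(t)\big),\ t\in[0,T],\quad \mathbf{x}(0)=\mathbf{x}_0,$$ then $\mathcal{G}^*$ is a solution operator up to measure zero sets with respect to the measure $\nu=\rho\times\mu$. That is, for $\nu$-almost every pair $(B,\mathbf{x}_0)$, $$\mathcal{G}^*(B,\mathbf{x}_0)(t)=\mathbf{u}^*(t)\in\arg\min_{\mathbf{u}(t)} J_B(\mathbf{x}(t),\mathbf{u}(t)),$$ with $\mathbf{x}(t)$ satisfying $\dot{\mathbf{x}}(t)=\mathbf{f}(t,\mathbf{x}(t),\mathbf{u}(t))$ for $t\in[0,T]$ and $\mathbf{x}(0)=\mathbf{x}_0$.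
   Context: $\Omega=\mathbb{R}^D$ is the state space, and controls $\mathbf{u}(t)$ take values in the admissible set $\mathcal{S}=\mathbb{R}^q$. For an environment function $B\in C([0,T]\times\Omega)$ and an initial state $\mathbf{x}_0\in\Omega$, the open-loop optimal control problem is to minimize over $\mathbf{u}(t)$ the cost functional $$J_B(\mathbf{x}(t),\mathbf{u}(t))=\int_0^T L_B(t,\mathbf{x}(t),\mathbf{u}(t))\,dt+M(\mathbf{x}(T)),$$ with running cost $L_B$ and terminal cost $M$, subject to the dynamics $\dot{\mathbf{x}}(t)=\mathbf{f}(t,\mathbf{x}(t),\mathbf{u}(t))$, $t\in[0,T]$, $\mathbf{x}(0)=\mathbf{x}_0$. A minimizer is denoted $\mathbf{u}^*(t)=\mathbf{u}^*(t;B,\mathbf{x}_0)$. The solution operator is the map $C([0,T]\times\Omega)\times\Omega\to C([0,T],\mathcal{S})$, $(B,\mathbf{x}_0)\mapsto\mathbf{u}^*(t;B,\mathbf{x}_0)$, sending a problem instance to the corresponding optimal control function. The operators $\mathcal{G}$ in the amortized training problem are maps of this type, from pairs $(B,\mathbf{x}_0)$ to control functions. $\rho$ is a probability measure on $\Omega$ (distribution of the initial state) and $\mu$ is a probability measure on $C([0,T]\times\Omega)$ (distribution of the environment function). Throughout, $\rho$ is supported on a $d$-dimensional Riemannian submanifold $\mathcal{X}\subset\Omega$ and $\mu$ on a $k$-dimensional Riemannian submanifold $\mathcal{M}\subset C([0,T]\times\Omega)$, both with reach $\tau>0$, and there is a constant $E>0$ such that for all $(B,\mathbf{x}_0)\in\mathcal{M}\times\mathcal{X}$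 each coordinate of $\mathbf{x}_0$ and all values of $B$ are bounded by $E$ in absolute value.
   Formalization: The formal statement adds that the optimal cost, as a function of (B, x0), is measurable, and that the expected costs being compared are finite; without measurability of the optimal cost the claim can fail. *)

theory Defs
  imports "HOL-Probability.Probability"
begin

text \<open>Functions in \<open>C([0,T] \<times> \<Omega>)\<close> are extensional, so that each has one representative.
  No boundedness is imposed.\<close>

definition env :: "real \<Rightarrow> (real \<times> (real ^ 'D) \<Rightarrow> real) set" where
  "env T = {B \<in> extensional ({0..T} \<times> UNIV). continuous_on ({0..T} \<times> UNIV) B}"

text \<open>The sigma-algebra generated by the point evaluations; it is the Borel sigma-algebra of
  the topology of locally uniform convergence.\<close>

definition env_algebra :: "real \<Rightarrow> (real \<times> (real ^ 'D) \<Rightarrow> real) measure" where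
  "env_algebra T = restrict_space (PiM ({0..T} \<times> UNIV) (\<lambda>_. borel)) (env T)"

text \<open>\<open>C([0,T], S)\<close> with \<open>S = \<real>\<^sup>q\<close>; values outside \<open>[0,T]\<close> are never used.\<close>

definition controls :: "real \<Rightarrow> (real \<Rightarrow> real ^ 'q) set" where
  "controls T = {u. continuous_on {0..T} u}"

definition cost ::
  "real \<Rightarrow> ('b \<Rightarrow> real \<Rightarrow> real ^ 'D \<Rightarrow> real ^ 'q \<Rightarrow> real) \<Rightarrow> (real ^ 'D \<Rightarrow> real)
    \<Rightarrow> 'b \<Rightarrow> (real \<Rightarrow> real ^ 'D) \<Rightarrow> (real \<Rightarrow> real ^ 'q) \<Rightarrow> real" where
  "cost T L Mc B x u = (LINT t:{0..T}|lborel. L B t (x t) (u t)) + Mc (x T)"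

text \<open>Integrability of the running cost says that the cost of the pair is defined; without it
  the Lebesgue integral in \<^const>\<open>cost\<close> would silently be 0.\<close>

definition admissible ::
  "real \<Rightarrow> (real \<Rightarrow> real ^ 'D \<Rightarrow> real ^ 'q \<Rightarrow> real ^ 'D)
    \<Rightarrow> ('b \<Rightarrow> real \<Rightarrow> real ^ 'D \<Rightarrow> real ^ 'q \<Rightarrow> real)
    \<Rightarrow> 'b \<Rightarrow> real ^ 'D \<Rightarrow> (real \<Rightarrow> real ^ 'D) \<Rightarrow> (real \<Rightarrow> real ^ 'q) \<Rightarrow> bool" where
  "admissible T f L B x0 x u \<longleftrightarrow>
     u \<in> controls T \<and>
     (\<forall>t\<in>{0..T}. (x has_vector_derivative f t (x t) (u t)) (at t within {0..T})) \<and>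
     x 0 = x0 \<and>
     set_integrable lborel {0..T} (\<lambda>t. L B t (x t) (u t))"

definition optimal_pair ::
  "real \<Rightarrow> (real \<Rightarrow> real ^ 'D \<Rightarrow> real ^ 'q \<Rightarrow> real ^ 'D)
    \<Rightarrow> ('b \<Rightarrow> real \<Rightarrow> real ^ 'D \<Rightarrow> real ^ 'q \<Rightarrow> real) \<Rightarrow> (real ^ 'D \<Rightarrow> real)
    \<Rightarrow> 'b \<Rightarrow> real ^ 'D \<Rightarrow> (real \<Rightarrow> real ^ 'D) \<Rightarrow> (real \<Rightarrow> real ^ 'q) \<Rightarrow> bool" where
  "optimal_pair T f L Mc B x0 x u \<longleftrightarrow>
     admissible T f L B x0 x u \<and>
     (\<forall>x' u'. admissible T f L B x0 x' u' \<longrightarrow> cost T L Mc B x u \<le> cost T L Mc B x' u')"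

text \<open>The set of minimizers \<open>u\<^sup>*\<close>. The state equation is a constraint on the pair of state and
  control, so no unique solvability of the dynamics is presupposed; if the trajectory is
  determined by the control, the quantifier over trajectories is harmless.\<close>

definition optimal_controls ::
  "real \<Rightarrow> (real \<Rightarrow> real ^ 'D \<Rightarrow> real ^ 'q \<Rightarrow> real ^ 'D)
    \<Rightarrow> ('b \<Rightarrow> real \<Rightarrow> real ^ 'D \<Rightarrow> real ^ 'q \<Rightarrow> real) \<Rightarrow> (real ^ 'D \<Rightarrow> real)
    \<Rightarrow> 'b \<Rightarrow> real ^ 'D \<Rightarrow> (real \<Rightarrow> real ^ 'q) set" where
  "optimal_controls T f L Mc B x0 = {u. \<exists>x. optimal_pair T f L Mc B x0 x u}"

definition control_operator ::
  "real \<Rightarrow> ((real \<times> (real ^ 'D) \<Rightarrow> real) \<times> (real ^ 'D) \<Rightarrow> real \<Rightarrow> real ^ 'q) \<Rightarrow> bool" where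
  "control_operator T G \<longleftrightarrow> (\<forall>B\<in>env T. \<forall>x0. G (B, x0) \<in> controls T)"

text \<open>\<open>Y (B, x0)\<close> is the optimal trajectory that belongs to the optimal control \<open>U (B, x0)\<close>;
  \<open>I\<close> is the set of problem instances.\<close>

definition solution_operator ::
  "real \<Rightarrow> (real \<Rightarrow> real ^ 'D \<Rightarrow> real ^ 'q \<Rightarrow> real ^ 'D)
    \<Rightarrow> ((real \<times> (real ^ 'D) \<Rightarrow> real) \<Rightarrow> real \<Rightarrow> real ^ 'D \<Rightarrow> real ^ 'q \<Rightarrow> real)
    \<Rightarrow> (real ^ 'D \<Rightarrow> real) \<Rightarrow> ((real \<times> (real ^ 'D) \<Rightarrow> real) \<times> (real ^ 'D)) set
    \<Rightarrow> ((real \<times> (real ^ 'D) \<Rightarrow> real) \<times> (real ^ 'D) \<Rightarrow> real \<Rightarrow> real ^ 'D)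
    \<Rightarrow> ((real \<times> (real ^ 'D) \<Rightarrow> real) \<times> (real ^ 'D) \<Rightarrow> real \<Rightarrow> real ^ 'q) \<Rightarrow> bool" where
  "solution_operator T f L Mc I Y U \<longleftrightarrow>
     control_operator T U \<and>
     (\<forall>(B, x0)\<in>I. optimal_pair T f L Mc B x0 (Y (B, x0)) (U (B, x0)))"

definition operator_cost ::
  "real \<Rightarrow> ('b \<Rightarrow> real \<Rightarrow> real ^ 'D \<Rightarrow> real ^ 'q \<Rightarrow> real) \<Rightarrow> (real ^ 'D \<Rightarrow> real)
    \<Rightarrow> ('b \<times> (real ^ 'D) \<Rightarrow> real \<Rightarrow> real ^ 'D) \<Rightarrow> ('b \<times> (real ^ 'D) \<Rightarrow> real \<Rightarrow> real ^ 'q)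
    \<Rightarrow> 'b \<times> (real ^ 'D) \<Rightarrow> real" where
  "operator_cost T L Mc X G = (\<lambda>(B, x0). cost T L Mc B (X (B, x0)) (G (B, x0)))"

definition risk ::
  "real \<Rightarrow> ('b \<Rightarrow> real \<Rightarrow> real ^ 'D \<Rightarrow> real ^ 'q \<Rightarrow> real) \<Rightarrow> (real ^ 'D \<Rightarrow> real)
    \<Rightarrow> 'b measure \<Rightarrow> (real ^ 'D) measure
    \<Rightarrow> ('b \<times> (real ^ 'D) \<Rightarrow> real \<Rightarrow> real ^ 'D) \<Rightarrow> ('b \<times> (real ^ 'D) \<Rightarrow> real \<Rightarrow> real ^ 'q)
    \<Rightarrow> real" where
  "risk T L Mc \<mu> \<rho> X G = (LINT B|\<mu>. LINT x0|\<rho>. operator_cost T L Mc X G (B, x0))"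

text \<open>The competitors: operators \<open>G\<close> with trajectories \<open>X (B, x0)\<close> driven by \<open>G (B, x0)\<close> for
  every problem instance, whose risk is a well-defined finite expectation. No measurability of
  \<open>G\<close> itself is required.\<close>

definition training_feasible ::
  "real \<Rightarrow> (real \<Rightarrow> real ^ 'D \<Rightarrow> real ^ 'q \<Rightarrow> real ^ 'D)
    \<Rightarrow> ((real \<times> (real ^ 'D) \<Rightarrow> real) \<Rightarrow> real \<Rightarrow> real ^ 'D \<Rightarrow> real ^ 'q \<Rightarrow> real)
    \<Rightarrow> (real ^ 'D \<Rightarrow> real) \<Rightarrow> ((real \<times> (real ^ 'D) \<Rightarrow> real) \<times> (real ^ 'D)) set
    \<Rightarrow> (real \<times> (real ^ 'D) \<Rightarrow> real) measure \<Rightarrow> (real ^ 'D) measure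
    \<Rightarrow> ((real \<times> (real ^ 'D) \<Rightarrow> real) \<times> (real ^ 'D) \<Rightarrow> real \<Rightarrow> real ^ 'D)
    \<Rightarrow> ((real \<times> (real ^ 'D) \<Rightarrow> real) \<times> (real ^ 'D) \<Rightarrow> real \<Rightarrow> real ^ 'q) \<Rightarrow> bool" where
  "training_feasible T f L Mc I \<mu> \<rho> X G \<longleftrightarrow>
     control_operator T G \<and>
     (\<forall>(B, x0)\<in>I. admissible T f L B x0 (X (B, x0)) (G (B, x0))) \<and>
     integrable (\<mu> \<Otimes>\<^sub>M \<rho>) (operator_cost T L Mc X G)"

definition training_minimizers ::
  "real \<Rightarrow> (real \<Rightarrow> real ^ 'D \<Rightarrow> real ^ 'q \<Rightarrow> real ^ 'D)
    \<Rightarrow> ((real \<times> (real ^ 'D) \<Rightarrow> real) \<Rightarrow> real \<Rightarrow> real ^ 'D \<Rightarrow> real ^ 'q \<Rightarrow> real)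
    \<Rightarrow> (real ^ 'D \<Rightarrow> real) \<Rightarrow> ((real \<times> (real ^ 'D) \<Rightarrow> real) \<times> (real ^ 'D)) set
    \<Rightarrow> (real \<times> (real ^ 'D) \<Rightarrow> real) measure \<Rightarrow> (real ^ 'D) measure
    \<Rightarrow> ((real \<times> (real ^ 'D) \<Rightarrow> real) \<times> (real ^ 'D) \<Rightarrow> real \<Rightarrow> real ^ 'q) set" where
  "training_minimizers T f L Mc I \<mu> \<rho> =
     {G. \<exists>X. training_feasible T f L Mc I \<mu> \<rho> X G \<and>
        (\<forall>X' G'. training_feasible T f L Mc I \<mu> \<rho> X' G' \<longrightarrow>
           risk T L Mc \<mu> \<rho> X G \<le> risk T L Mc \<mu> \<rho> X' G')}"

text \<open>\<open>C_diff n S W f\<close>: \<open>f\<close> is \<open>n\<close> times continuously differentiable on the relatively open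
  subset \<open>W\<close> of the finite-dimensional subspace \<open>S\<close>, by means of iterated directional
  derivatives along \<open>S\<close>. The derivative \<open>D x\<close> within \<open>W\<close> is unique on \<open>S\<close> only, which is
  why directions range over \<open>S\<close>.\<close>

primrec C_diff ::
  "nat \<Rightarrow> 'a::real_normed_vector set \<Rightarrow> 'a set \<Rightarrow> ('a \<Rightarrow> 'a) \<Rightarrow> bool" where
  "C_diff 0 S W f \<longleftrightarrow> continuous_on W f"
| "C_diff (Suc n) S W f \<longleftrightarrow>
     (\<exists>D. (\<forall>x\<in>W. (f has_derivative D x) (at x within W)) \<and>
          (\<forall>v\<in>S. C_diff n S W (\<lambda>x. D x v)))"

text \<open>Smooth embedded \<open>k\<close>-dimensional submanifolds of a normed space of possibly infinite
  dimension: locally the image of a smooth immersion that is a homeomorphism onto a relatively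
  open part. A \<open>k\<close>-dimensional subspace \<open>span b\<close> of the ambient space replaces the parameter
  space \<open>\<real>\<^sup>k\<close>. In an inner product space the Riemannian metric is the induced one, so being a
  Riemannian submanifold is no further condition on the set.\<close>

definition embedded_submanifold :: "nat \<Rightarrow> 'a::real_normed_vector set \<Rightarrow> bool" where
  "embedded_submanifold k A \<longleftrightarrow>
     (\<forall>a\<in>A. \<exists>b W \<phi> \<psi>.
        finite b \<and> independent b \<and> card b = k \<and>
        openin (top_of_set (span b)) W \<and>
        openin (top_of_set A) (\<phi> ` W) \<and> a \<in> \<phi> ` W \<and>
        homeomorphism W (\<phi> ` W) \<phi> \<psi> \<and>
        (\<forall>n. C_diff n (span b) W \<phi>) \<and>
        (\<forall>x\<in>W. \<exists>\<phi>'. (\<phi> has_derivative \<phi>') (at x within W) \<and> inj_on \<phi>' (span b)))"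

text \<open>The reach in the sense of Federer; it is infinite for instance for nonempty closed convex sets in
  Euclidean space.\<close>

definition reach :: "'a::metric_space set \<Rightarrow> ereal" where
  "reach A = Sup {ereal r | r. \<forall>z. infdist z A < r \<longrightarrow> (\<exists>!a. a \<in> A \<and> dist z a = infdist z A)}"

text \<open>Dimension and reach of a subset of \<open>C([0,T] \<times> \<Omega>)\<close> refer to a normed (for instance, inner
  product) space of functions. As \<open>\<Omega>\<close> is not compact there is no canonical choice; an injective
  \<open>\<iota>\<close>, linear at each point, presents an arbitrary such space \<open>'h\<close> as a space of continuous
  functions on \<open>[0,T] \<times> \<Omega>\<close>.\<close>

definition function_space ::
  "real \<Rightarrow> ('h::real_normed_vector \<Rightarrow> real \<times> (real ^ 'D) \<Rightarrow> real) \<Rightarrow> bool" where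
  "function_space T \<iota> \<longleftrightarrow>
     range \<iota> \<subseteq> env T \<and> inj \<iota> \<and> (\<forall>p\<in>{0..T} \<times> UNIV. linear (\<lambda>h. \<iota> h p))"

end

theory Submission
  imports Defs
begin

text \<open>On every instance the solution operator costs at most as much as the trained operator, so
  replacing the latter by the former on a measurable set of instances cannot raise the risk, and
  minimality forces equality of the costs almost everywhere on that set. The cost of the solution
  operator need not be integrable; therefore the replacement is done on the set where the costs
  differ by at most \<open>n\<close>, and these sets exhaust all instances as \<open>n\<close> grows.\<close>

text \<open>The difference \<open>g - h\<close> is nonnegative almost everywhere and has integral at
  most 0, so it vanishes almost everywhere.\<close>

lemma AE_eq_of_integral_le:
  fixes g h :: "'a \<Rightarrow> real"
  assumes g: "integrable M g" and h: "integrable M h"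
    and le: "AE p in M. h p \<le> g p" and int: "integral\<^sup>L M g \<le> integral\<^sup>L M h"
  shows "AE p in M. g p = h p"
proof -
  have int_diff: "integrable M (\<lambda>p. g p - h p)"
    using g h by simp
  have nonneg: "AE p in M. 0 \<le> g p - h p"
    using le by simp
  have "integral\<^sup>L M (\<lambda>p. g p - h p) \<le> 0"
    using g h int by simp
  then have "integral\<^sup>L M (\<lambda>p. g p - h p) = 0"
    using integral_nonneg_AE[OF nonneg] by linarith
  then have "AE p in M. g p - h p = 0"
    using integral_nonneg_eq_0_iff_AE[OF int_diff nonneg] by simp
  then show ?thesis by simp
qed

text \<open>The exchange argument without control theory: \<open>g\<close> plays the cost of the
  trained operator, \<open>u\<close> that of the solution operator. Minimality is only available for
  switched functions that are integrable.\<close>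

lemma (in finite_measure) AE_eq_of_switching_minimal:
  fixes g u :: "'a \<Rightarrow> real"
  assumes g: "integrable M g" and u: "u \<in> borel_measurable M"
    and le: "AE p in M. u p \<le> g p"
    and switch: "\<And>A. A \<in> sets M \<Longrightarrow> integrable M (\<lambda>p. if p \<in> A then u p else g p) \<Longrightarrow>
      integral\<^sup>L M g \<le> (\<integral>p. (if p \<in> A then u p else g p) \<partial>M)"
  shows "AE p in M. g p = u p"
proof -
  note g_meas = borel_measurable_integrable[OF g]
  have "AE p in M. g p - real n \<le> u p \<longrightarrow> g p = u p" for n
  proof -
    \<comment> \<open>On \<open>A\<close> the value \<open>u p\<close> lies between
      \<open>g p - n\<close> and \<open>g p\<close>. Hence \<open>h\<close> is dominated by
      \<open>\<bar>g p\<bar> + n\<close>, which is integrable since the measure is finite.\<close>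
    define A where "A = {p \<in> space M. g p - real n \<le> u p}"
    define h where "h = (\<lambda>p. if p \<in> A then u p else g p)"
    have A: "A \<in> sets M"
      unfolding A_def using g_meas u by measurable
    have h_meas: "h \<in> borel_measurable M"
      unfolding h_def by (intro measurable_If_set u g_meas) (use A in simp)
    have h: "integrable M h"
    proof (rule Bochner_Integration.integrable_bound)
      show "integrable M (\<lambda>p. \<bar>g p\<bar> + real n)"
        using g by simp
      show "AE p in M. norm (h p) \<le> norm (\<bar>g p\<bar> + real n)"
        using le by eventually_elim (auto simp: h_def A_def)
    qed (rule h_meas)
    have "AE p in M. g p = h p"
    proof (rule AE_eq_of_integral_le[OF g h])
      show "AE p in M. h p \<le> g p"
        using le by eventually_elim (simp add: h_def)
      show "integral\<^sup>L M g \<le> integral\<^sup>L M h"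
        using switch[OF A] h unfolding h_def by simp
    qed
    \<comment> \<open>For \<open>p\<close> in the space, the premise puts \<open>p\<close> into
      \<open>A\<close>, where \<open>h\<close> is \<open>u\<close>.\<close>
    with AE_space show ?thesis
      by eventually_elim (auto simp: h_def A_def)
  qed
  then have "AE p in M. \<forall>n. g p - real n \<le> u p \<longrightarrow> g p = u p"
    unfolding AE_all_countable by blast
  then show ?thesis
  proof eventually_elim
    case (elim p)
    obtain n where "g p - u p \<le> real n"
      using real_arch_simple by blast
    then show ?case using elim by (auto simp: algebra_simps)
  qed
qed

text \<open>\<open>A\<close> and \<open>B\<close> may be nonmeasurable, so the exceptional sets are
  first covered by measurable null sets; a strip over a null set is null in the product.\<close>

lemma (in pair_sigma_finite) AE_pair_mem_Times:
  assumes "AE x in M1. x \<in> A" and "AE y in M2. y \<in> B"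
  shows "AE p in M1 \<Otimes>\<^sub>M M2. p \<in> A \<times> B"
proof -
  from assms(1) obtain N1 where N1: "{x \<in> space M1. x \<notin> A} \<subseteq> N1" "emeasure M1 N1 = 0" "N1 \<in> sets M1"
    by (rule AE_E)
  from assms(2) obtain N2 where N2: "{y \<in> space M2. y \<notin> B} \<subseteq> N2" "emeasure M2 N2 = 0" "N2 \<in> sets M2"
    by (rule AE_E)
  let ?N = "N1 \<times> space M2 \<union> space M1 \<times> N2"
  have "N1 \<times> space M2 \<in> null_sets (M1 \<Otimes>\<^sub>M M2)" "space M1 \<times> N2 \<in> null_sets (M1 \<Otimes>\<^sub>M M2)"
    using N1 N2 by (auto simp: null_sets_def M2.emeasure_pair_measure_Times)
  then have "?N \<in> null_sets (M1 \<Otimes>\<^sub>M M2)"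
    by (rule null_sets.Un)
  then show ?thesis
    by (rule AE_I') (use N1(1) N2(1) in \<open>auto simp: space_pair_measure\<close>)
qed

text \<open>Fubini: integrability on the product turns the iterated expectation into a single
  integral.\<close>

lemma risk_eq_integral_pair:
  assumes "prob_space \<mu>" "prob_space \<rho>"
    and "integrable (\<mu> \<Otimes>\<^sub>M \<rho>) (operator_cost T L Mc X G)"
  shows "risk T L Mc \<mu> \<rho> X G = integral\<^sup>L (\<mu> \<Otimes>\<^sub>M \<rho>) (operator_cost T L Mc X G)"
proof -
  interpret \<mu>: prob_space \<mu> by fact
  interpret \<rho>: prob_space \<rho> by fact
  interpret pair_sigma_finite \<mu> \<rho> ..
  show ?thesis
    unfolding risk_def using integral_fst'[OF assms(3)] by simp
qed

lemma operator_cost_if: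
  "operator_cost T L Mc (\<lambda>p. if p \<in> A then Y p else X p) (\<lambda>p. if p \<in> A then U p else G p) =
    (\<lambda>p. if p \<in> A then operator_cost T L Mc Y U p else operator_cost T L Mc X G p)"
  by (auto simp: operator_cost_def fun_eq_iff)

text \<open>The constraints are imposed instance by instance, so they survive any splicing of two
  operators with their trajectories; only integrability of the cost is a joint condition.\<close>

lemma training_feasible_if:
  assumes "training_feasible T f L Mc I \<mu> \<rho> X G" and "solution_operator T f L Mc I Y U"
    and "integrable (\<mu> \<Otimes>\<^sub>M \<rho>)
      (\<lambda>p. if p \<in> A then operator_cost T L Mc Y U p else operator_cost T L Mc X G p)"
  shows "training_feasible T f L Mc I \<mu> \<rho>
    (\<lambda>p. if p \<in> A then Y p else X p) (\<lambda>p. if p \<in> A then U p else G p)"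
  using assms unfolding training_feasible_def operator_cost_if
  by (fastforce simp: solution_operator_def control_operator_def optimal_pair_def)

text \<open>On \<open>\<M> \<times> \<X>\<close> the cost of \<open>U\<close> along \<open>Y\<close>
  is the value function of the control problem. Thus \<open>solution_cost\<close> concerns
  measurability of the optimal values, not of the selection \<open>U\<close>.\<close>

theorem theorem1:
  fixes T \<tau> E :: real
    and d k :: nat
    and f :: "real \<Rightarrow> real ^ 'D \<Rightarrow> real ^ 'q \<Rightarrow> real ^ 'D"
    and L :: "(real \<times> (real ^ 'D) \<Rightarrow> real) \<Rightarrow> real \<Rightarrow> real ^ 'D \<Rightarrow> real ^ 'q \<Rightarrow> real"
    and Mc :: "real ^ 'D \<Rightarrow> real"
    and \<rho> :: "(real ^ 'D) measure"
    and \<mu> :: "(real \<times> (real ^ 'D) \<Rightarrow> real) measure"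
    and \<X> :: "(real ^ 'D) set"
    and \<M> :: "(real \<times> (real ^ 'D) \<Rightarrow> real) set"
    and \<iota> :: "'h::real_normed_vector \<Rightarrow> real \<times> (real ^ 'D) \<Rightarrow> real"
    and Y :: "(real \<times> (real ^ 'D) \<Rightarrow> real) \<times> (real ^ 'D) \<Rightarrow> real \<Rightarrow> real ^ 'D"
    and U G :: "(real \<times> (real ^ 'D) \<Rightarrow> real) \<times> (real ^ 'D) \<Rightarrow> real \<Rightarrow> real ^ 'q"
  assumes T: "0 < T" and \<tau>: "0 < \<tau>" and E: "0 < E"
    and \<rho>: "prob_space \<rho>" "sets \<rho> = sets borel" "AE x in \<rho>. x \<in> \<X>"
    and \<X>: "embedded_submanifold d \<X>" "ereal \<tau> \<le> reach \<X>"
    and \<mu>: "prob_space \<mu>" "sets \<mu> = sets (env_algebra T)" "AE B in \<mu>. B \<in> \<M>"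
    and \<iota>: "function_space T \<iota>"
    and \<M>: "\<M> \<subseteq> range \<iota>" "embedded_submanifold k (\<iota> -` \<M>)" "ereal \<tau> \<le> reach (\<iota> -` \<M>)"
    and \<X>_bound: "\<forall>x\<in>\<X>. \<forall>i. \<bar>x $ i\<bar> \<le> E"
    and \<M>_bound: "\<forall>B\<in>\<M>. \<forall>p\<in>{0..T} \<times> UNIV. \<bar>B p\<bar> \<le> E"
    and solution: "solution_operator T f L Mc (\<M> \<times> \<X>) Y U"
    and solution_cost: "operator_cost T L Mc Y U \<in> borel_measurable (\<mu> \<Otimes>\<^sub>M \<rho>)"
    and training: "G \<in> training_minimizers T f L Mc (\<M> \<times> \<X>) \<mu> \<rho>"
  shows "AE (B, x0) in \<mu> \<Otimes>\<^sub>M \<rho>. G (B, x0) \<in> optimal_controls T f L Mc B x0"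
proof -
  interpret \<mu>: prob_space \<mu> by fact
  interpret \<rho>: prob_space \<rho> by fact
  interpret P: pair_prob_space \<mu> \<rho> ..
  let ?I = "\<M> \<times> \<X>"
  from training obtain X where feas: "training_feasible T f L Mc ?I \<mu> \<rho> X G"
    and minimal: "\<And>X' G'. training_feasible T f L Mc ?I \<mu> \<rho> X' G' \<Longrightarrow>
      risk T L Mc \<mu> \<rho> X G \<le> risk T L Mc \<mu> \<rho> X' G'"
    unfolding training_minimizers_def by blast
  let ?g = "operator_cost T L Mc X G" and ?u = "operator_cost T L Mc Y U"
  have adm: "admissible T f L B x0 (X (B, x0)) (G (B, x0))" if "(B, x0) \<in> ?I" for B x0
    using feas that unfolding training_feasible_def by blast
  have opt: "optimal_pair T f L Mc B x0 (Y (B, x0)) (U (B, x0))" if "(B, x0) \<in> ?I" for B x0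
    using solution that unfolding solution_operator_def by blast
  have int_g: "integrable (\<mu> \<Otimes>\<^sub>M \<rho>) ?g"
    using feas unfolding training_feasible_def by blast
  have in_I: "AE p in \<mu> \<Otimes>\<^sub>M \<rho>. p \<in> ?I"
    using \<mu>(3) \<rho>(3) by (rule P.AE_pair_mem_Times)
  have "AE p in \<mu> \<Otimes>\<^sub>M \<rho>. ?g p = ?u p"
  proof (rule P.P.AE_eq_of_switching_minimal[OF int_g solution_cost])
    show "AE p in \<mu> \<Otimes>\<^sub>M \<rho>. ?u p \<le> ?g p"
      using in_I
    proof eventually_elim
      case (elim p)
      then show ?case
        using adm opt by (cases p) (auto simp: operator_cost_def optimal_pair_def)
    qed
  next
    fix A assume int: "integrable (\<mu> \<Otimes>\<^sub>M \<rho>) (\<lambda>p. if p \<in> A then ?u p else ?g p)"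
    \<comment> \<open>The spliced operator competes in the training problem.\<close>
    note minimal[OF training_feasible_if[OF feas solution int]]
    then show "integral\<^sup>L (\<mu> \<Otimes>\<^sub>M \<rho>) ?g \<le> (\<integral>p. (if p \<in> A then ?u p else ?g p) \<partial>(\<mu> \<Otimes>\<^sub>M \<rho>))"
      using int int_g \<mu>(1) \<rho>(1) by (simp add: risk_eq_integral_pair operator_cost_if)
  qed
  with in_I show ?thesis
  proof eventually_elim
    case (elim p)
    obtain B x0 where p: "p = (B, x0)" by (cases p)
    \<comment> \<open>An admissible pair whose cost equals the minimum is itself optimal; the
      trajectory \<open>X\<close> from training is the witness.\<close>
    have "optimal_pair T f L Mc B x0 (X (B, x0)) (G (B, x0))"
      using elim adm[of B x0] opt[of B x0] by (auto simp: p optimal_pair_def operator_cost_def)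
    then show ?case
      by (auto simp: p optimal_controls_def)
  qed
qed

end
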